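(* Let $C\subset\mathbb{R}^2$ be a regular polygon with an even number $2k$ of vertices, centered at the origin, and consider the Minkowski plane $(\mathbb{R}^2, C)$ whose unit circle is $C$. If $C$ has at most $22$ vertices (i.e. $k\le 11$), then there exists a regular proper $6$-coloring of $(\mathbb{R}^2,C)$, i.e. a partition of $\mathbb{R}^2$ into $6$ color classes that are translates of one another, such that no two points at unit $C$-distance receive the same color. Consequently $\chi(\mathbb{R}^2, C)\le 6$ for every regular $2k$-gon $C$ with $k\le 11$.
   Context: For a centrally symmetric bounded convex domain $C\subset\mathbb{R}^2$ centered at the origin, the $C$-norm of $x\in\mathbb{R}^2$ is $\|x\|_C=\min\{\lambda>0 : x\in\lambda C\}$, and the $C$-distance of $x,y$ is $\|x-y\|_C$; $(\mathbb{R}^2,C)$ denotes the plane with this distance. A proper $k$-coloring is a partition of the plane into $k$ color classes none of which contains two points at unit $C$-distance; $\chi(\mathbb{R}^2,C)$ is the minimum $k$ for which a proper $k$-coloring exists. A proper $k$-coloring with classes $C_1,\dots,C_k$ is called regular if there exist vectors $v_1,\dots,v_k$ with $C_i=C_1+v_i$ for $i=1,\dots,k$. *)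

theory Defs
  imports "HOL-Analysis.Analysis" "HOL-Library.Extended_Nat" "HOL-Library.Disjoint_Sets"
begin

text \<open>A polygon is the closed region it bounds, not its boundary curve. Radius and
  orientation are arbitrary.\<close>

definition regular_polygon :: "nat \<Rightarrow> real^2 \<Rightarrow> (real^2) set \<Rightarrow> bool" where
  "regular_polygon n c P \<longleftrightarrow> n \<ge> 3 \<and>
     (\<exists>r>0. \<exists>\<theta>. P = convex hull
        ((\<lambda>j. c + r *\<^sub>R vector [cos (\<theta> + 2 * pi * real j / real n),
                               sin (\<theta> + 2 * pi * real j / real n)]) ` {..<n}))"

text \<open>For compact \<open>C\<close> with \<open>0\<close> in its interior the infimum is a minimum, except at \<open>x = 0\<close>,
  where it is \<open>0\<close>.\<close>

definition C_norm :: "(real^2) set \<Rightarrow> real^2 \<Rightarrow> real" where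
  "C_norm C x = Inf {t. t > 0 \<and> x \<in> (\<lambda>y. t *\<^sub>R y) ` C}"

definition C_dist :: "(real^2) set \<Rightarrow> real^2 \<Rightarrow> real^2 \<Rightarrow> real" where
  "C_dist C x y = C_norm C (x - y)"

definition proper_coloring :: "(real^2) set \<Rightarrow> nat \<Rightarrow> (nat \<Rightarrow> (real^2) set) \<Rightarrow> bool" where
  "proper_coloring C k K \<longleftrightarrow>
     disjoint_family_on K {1..k} \<and> (\<Union>i\<in>{1..k}. K i) = UNIV \<and> (\<forall>i\<in>{1..k}. K i \<noteq> {}) \<and>
     (\<forall>i\<in>{1..k}. \<forall>x\<in>K i. \<forall>y\<in>K i. C_dist C x y \<noteq> 1)"

definition regular_coloring :: "nat \<Rightarrow> (nat \<Rightarrow> (real^2) set) \<Rightarrow> bool" where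
  "regular_coloring k K \<longleftrightarrow> (\<exists>v. \<forall>i\<in>{1..k}. K i = (\<lambda>x. x + v i) ` K 1)"

text \<open>The value is \<open>\<infinity>\<close> if no proper coloring with finitely many classes exists.\<close>

definition chromatic_number :: "(real^2) set \<Rightarrow> enat" where
  "chromatic_number C = Inf {enat k | k. \<exists>K. proper_coloring C k K}"

end

theory Submission
  imports Defs
begin

text \<open>Rotate and scale so that \<open>C\<close> is the set where finitely many functionals
  \<open>x cos (m pi / k) + y sin (m pi / k)\<close>, \<open>m < k\<close>, are at most \<open>1\<close> in absolute value; the
  \<open>C\<close>-norm is the maximum of these absolute values. Tile the plane by translates of a centrally
  symmetric hexagon with vertical edges on the lines \<open>x = 1/2\<close> and \<open>x = - 1/2\<close>, along the
  lattice generated by \<open>(1, 0)\<close> and \<open>(1/2 + p, d + q)\<close>, and give the tile at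
  \<open>i (1, 0) + j (1/2 + p, d + q)\<close> the colour \<open>3 i + j\<close> modulo \<open>6\<close>. There is
  no slack in the horizontal direction: a tile has width exactly \<open>1\<close>, and so has the gap
  between it and the next tile of its colour in the same row. Removing the left edge of the tiles
  makes both comparisons strict. All other constraints can be met with room to spare: points of one
  tile that are not on opposite vertical edges have distance less than \<open>1\<close>, and the differences
  between points of other equally coloured tiles are separated from \<open>C\<close> by a single functional. For
  each \<open>k \<le> 11\<close> rational parameters are exhibited and checked numerically.\<close>

subsection \<open>A hexagonal lattice tiling\<close>

text \<open>The hexagon with vertices \<open>(1/2, d)\<close>, \<open>(p, q)\<close>, \<open>(-1/2, d)\<close> and their negatives.\<close>

definition hexagon :: "real \<Rightarrow> real \<Rightarrow> real \<Rightarrow> real \<Rightarrow> real \<Rightarrow> bool" where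
  "hexagon d p q x y \<longleftrightarrow> \<bar>x\<bar> \<le> 1/2 \<and>
     (p + 1/2) * (y - d) \<le> (q - d) * (x + 1/2) \<and> (1/2 - p) * (y - d) \<le> (q - d) * (1/2 - x) \<and>
     (p + 1/2) * (- y - d) \<le> (q - d) * (1/2 - x) \<and> (1/2 - p) * (- y - d) \<le> (q - d) * (x + 1/2)"

lemma hexagon_minus: "hexagon d p q (- x) (- y) \<longleftrightarrow> hexagon d p q x y"
  unfolding hexagon_def by (auto simp: add.commute)

lemma hexagon_reflect: "hexagon d (- p) q (- x) y \<longleftrightarrow> hexagon d p q x y"
  unfolding hexagon_def by (auto simp: add.commute)

text \<open>The part of the strip \<open>0 \<le> y < d + q\<close> above the hexagon is covered by the hexagon of the
  next row.\<close>

lemma hexagon_shift: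
  assumes "0 < d" "d < q" "\<bar>p\<bar> < 1/2" and x: "\<bar>x\<bar> \<le> 1/2" "x \<le> p" and y: "0 \<le> y" "y < d + q"
    and outside: "\<not> hexagon d p q x y"
  shows "hexagon d p q (x + 1/2 - p) (y - (d + q))"
proof -
  have pos: "p + 1/2 > 0" "1/2 - p > 0" using assms by auto
  have below: "(p + 1/2) * (- y - d) \<le> 0" "(1/2 - p) * (- y - d) \<le> 0"
    using pos y assms by (auto intro!: mult_nonneg_nonpos)
  have nonneg: "0 \<le> (q - d) * (1/2 - x)" "0 \<le> (q - d) * (x + 1/2)"
    using assms by auto
  \<comment> \<open>Left of the apex only the upper left edge can fail: below that edge
    \<open>y \<le> q\<close>, and with \<open>x \<le> p\<close> the upper right inequality
    follows.\<close>
  have "\<not> (p + 1/2) * (y - d) \<le> (q - d) * (x + 1/2)"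
  proof
    assume *: "(p + 1/2) * (y - d) \<le> (q - d) * (x + 1/2)"
    also have "\<dots> \<le> (q - d) * (p + 1/2)" using assms by (intro mult_left_mono) auto
    finally have "y \<le> q" using pos by (simp add: mult.commute)
    then have "(1/2 - p) * (y - d) \<le> (1/2 - p) * (q - d)"
      using pos by (intro mult_left_mono) auto
    also have "\<dots> \<le> (1/2 - x) * (q - d)" using assms by (intro mult_right_mono) auto
    finally show False
      using outside * below nonneg x unfolding hexagon_def by (auto simp: mult.commute)
  qed
  then have above: "(q - d) * (x + 1/2) < (p + 1/2) * (y - d)" by simp
  have "d < y"
  proof (rule ccontr)
    assume "\<not> d < y"
    then have "(p + 1/2) * (y - d) \<le> 0" using pos by (intro mult_nonneg_nonpos) auto
    then show False using above nonneg by simp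
  qed
  define x' where "x' = x + 1/2 - p"
  define y' where "y' = y - (d + q)"
  have x': "\<bar>x'\<bar> \<le> 1/2" using assms(3) x unfolding x'_def by linarith
  have "y' - d \<le> 0" using y assms by (simp add: y'_def)
  then have "(p + 1/2) * (y' - d) \<le> 0" "(1/2 - p) * (y' - d) \<le> 0"
    using pos by (simp_all add: mult_nonneg_nonpos)
  moreover have "0 \<le> 1/2 - x'" "0 \<le> x' + 1/2" using x' by linarith+
  then have "0 \<le> (q - d) * (1/2 - x')" "0 \<le> (q - d) * (x' + 1/2)"
    using assms(2) by simp_all
  \<comment> \<open>The two hexagons share this edge, so \<open>above\<close> is the required
    inequality seen from the other side.\<close>
  moreover have "(p + 1/2) * (- y' - d) \<le> (q - d) * (1/2 - x')"
    using above by (simp add: x'_def y'_def algebra_simps diff_divide_distrib)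
  moreover have "(1/2 - p) * (- y' - d) \<le> (q - d) * (x' + 1/2)"
  proof -
    have "(1/2 - p) * (- y' - d) \<le> (1/2 - p) * (q - d)"
      using pos \<open>d < y\<close> by (intro mult_left_mono) (auto simp: y'_def)
    also have "\<dots> \<le> (x' + 1/2) * (q - d)"
      using x assms by (intro mult_right_mono) (auto simp: x'_def)
    finally show ?thesis by (simp add: mult.commute)
  qed
  ultimately show ?thesis
    using x' unfolding x'_def[symmetric] y'_def[symmetric] hexagon_def by auto
qed

text \<open>As \<open>s \<ge> 0\<close>, the functional grows towards the upper boundary, where it
  is linear on each of the two edges. Hence its values at the vertices \<open>(1/2, d)\<close>,
  \<open>(-1/2, d)\<close> and \<open>(p, q)\<close> control it; \<open>x\<close> gives the weights
  of the convex combination.\<close>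

lemma hexagon_linear_le:
  assumes "hexagon d p q x y" "\<bar>p\<bar> < 1/2" "s \<ge> 0"
    and "c / 2 + s * d \<le> B" "- c / 2 + s * d \<le> B" "c * p + s * q \<le> B"
  shows "c * x + s * y \<le> B"
proof (cases "x \<le> p")
  case True
  have "s * ((p + 1/2) * (y - d)) \<le> s * ((q - d) * (x + 1/2))"
    using assms by (intro mult_left_mono) (auto simp: hexagon_def)
  then have "(p + 1/2) * (c * x + s * y) \<le> (x + 1/2) * (c * p + s * q) + (p - x) * (- c / 2 + s * d)"
    by (simp add: field_simps)
  also have "\<dots> \<le> (x + 1/2) * B + (p - x) * B"
    using assms True by (intro add_mono mult_left_mono) (auto simp: hexagon_def)
  also have "\<dots> = (p + 1/2) * B"
    by (simp add: algebra_simps)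
  finally show ?thesis
    using assms(2) by (simp add: mult_le_cancel_left)
next
  case False
  have "s * ((1/2 - p) * (y - d)) \<le> s * ((q - d) * (1/2 - x))"
    using assms by (intro mult_left_mono) (auto simp: hexagon_def)
  then have "(1/2 - p) * (c * x + s * y) \<le> (1/2 - x) * (c * p + s * q) + (x - p) * (c / 2 + s * d)"
    by (simp add: field_simps)
  also have "\<dots> \<le> (1/2 - x) * B + (x - p) * B"
    using assms False by (intro add_mono mult_left_mono) (auto simp: hexagon_def)
  also have "\<dots> = (1/2 - p) * B"
    by (simp add: algebra_simps)
  finally show ?thesis
    using assms(2) by (simp add: mult_le_cancel_left)
qed

lemma hexagon_linear_abs_le:
  assumes "hexagon d p q x y" "\<bar>p\<bar> < 1/2" "s \<ge> 0"
    and "\<bar>c\<bar> / 2 + s * d \<le> B" "\<bar>c * p + s * q\<bar> \<le> B"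
  shows "\<bar>c * x + s * y\<bar> \<le> B"
proof (rule abs_leI)
  have "c / 2 + s * d \<le> B" "- c / 2 + s * d \<le> B" "c * p + s * q \<le> B"
    using assms(4,5) by linarith+
  note le = hexagon_linear_le[OF _ assms(2,3) this]
  show "c * x + s * y \<le> B"
    by (rule le[OF assms(1)])
  have "c * (- x) + s * (- y) \<le> B"
    using assms(1) by (intro le) (simp add: hexagon_minus)
  then show "- (c * x + s * y) \<le> B" by simp
qed

text \<open>The slanted edges are kept, so neighbouring tiles overlap there; the choice of
  representatives in \<open>lattice_coloring_exists\<close> resolves this.\<close>

definition in_tile :: "real \<Rightarrow> real \<Rightarrow> real \<Rightarrow> real \<times> real \<Rightarrow> bool" where
  "in_tile d p q P \<longleftrightarrow> hexagon d p q (fst P) (snd P) \<and> fst P > - 1/2"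

definition lattice_point :: "real \<Rightarrow> real \<Rightarrow> int \<Rightarrow> int \<Rightarrow> real \<times> real" where
  "lattice_point u h i j = (of_int i + of_int j * u, of_int j * h)"

lemma lattice_point_add:
  "lattice_point u h i j + lattice_point u h i' j' = lattice_point u h (i + i') (j + j')"
  by (simp add: lattice_point_def algebra_simps)

lemma lattice_point_diff:
  "lattice_point u h i j - lattice_point u h i' j' = lattice_point u h (i - i') (j - j')"
  by (simp add: lattice_point_def algebra_simps)

lemma lattice_point_eq_iff:
  "h > 0 \<Longrightarrow> lattice_point u h i j = lattice_point u h i' j' \<longleftrightarrow> i = i' \<and> j = j'"
  by (auto simp: lattice_point_def)

text \<open>A lattice shift brings the point into the box \<open>0 \<le> y < d + q\<close>,
  \<open>-1/2 < x \<le> 1/2\<close>, which is covered by the hexagon at the origin and two hexagons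
  of the next row.\<close>

lemma tiles_cover:
  assumes "0 < d" "d < q" "\<bar>p\<bar> < 1/2"
  shows "\<exists>i j. in_tile d p q (P - lattice_point (1/2 + p) (d + q) i j)"
proof -
  define h where "h = d + q"
  define u where "u = 1/2 + p"
  define j where "j = \<lfloor>snd P / h\<rfloor>"
  \<comment> \<open>The ceiling gives the interval open on the left, matching the removed left
    edge.\<close>
  define i where "i = \<lceil>fst P - of_int j * u - 1/2\<rceil>"
  define x where "x = fst P - of_int j * u - of_int i"
  define y where "y = snd P - of_int j * h"
  have h: "h > 0" using assms by (simp add: h_def)
  have "of_int j \<le> snd P / h" "snd P / h < of_int j + 1"
    unfolding j_def by linarith+
  then have y: "0 \<le> y" "y < h"
    using h by (auto simp: y_def field_simps)
  have x: "- 1/2 < x" "x \<le> 1/2"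
    unfolding x_def i_def by linarith+
  have P: "P - lattice_point u h (i + i') (j + j') = (x - of_int i' - of_int j' * u, y - of_int j' * h)" for i' j'
    by (cases P) (simp add: lattice_point_def x_def y_def algebra_simps)
  show ?thesis
  proof (cases "hexagon d p q x y")
    case True
    then have "in_tile d p q (P - lattice_point u h i j)"
      using P[of 0 0] x by (simp add: in_tile_def)
    then show ?thesis unfolding u_def h_def by blast
  next
    case outside: False
    show ?thesis
    proof (cases "x \<le> p")
      case True
      have "P - lattice_point u h (i - 1) (j + 1) = (x + 1/2 - p, y - (d + q))"
        using P[of "- 1" 1] by (simp add: u_def h_def)
      moreover have "hexagon d p q (x + 1/2 - p) (y - (d + q))"
        using assms x y outside True by (intro hexagon_shift) (auto simp: h_def)
      ultimately have "in_tile d p q (P - lattice_point u h (i - 1) (j + 1))"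
        using x assms by (simp add: in_tile_def)
      then show ?thesis unfolding u_def h_def by blast
    next
      case False
      have "P - lattice_point u h i (j + 1) = (x - 1/2 - p, y - (d + q))"
        using P[of 0 1] by (simp add: u_def h_def)
      \<comment> \<open>Right of the apex the picture is mirrored in the vertical axis, which
        replaces \<open>p\<close> by \<open>- p\<close>.\<close>
      moreover have "hexagon d (- p) q (- x + 1/2 - (- p)) (y - (d + q))"
        using assms x y outside False by (intro hexagon_shift) (auto simp: h_def hexagon_reflect)
      then have "hexagon d p q (x - 1/2 - p) (y - (d + q))"
        using hexagon_reflect[of d p q "x - 1/2 - p"] by (simp add: algebra_simps)
      ultimately have "in_tile d p q (P - lattice_point u h i (j + 1))"
        using False by (simp add: in_tile_def)
      then show ?thesis unfolding u_def h_def by blast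
    qed
  qed
qed

text \<open>The colour stays an integer until the final theorem, so that lattice shifts act on it by
  exact addition. In the second property \<open>3 * i + j = 6 * n\<close> describes the
  monochromatic sublattice.\<close>

lemma lattice_coloring_exists:
  assumes "0 < d" "d < q" "\<bar>p\<bar> < 1/2"
  defines "l \<equiv> lattice_point (1/2 + p) (d + q)"
  obtains col :: "real \<times> real \<Rightarrow> int" where
    "\<And>P i j. col (P + l i j) = col P + (3 * i + j)"
    "\<And>P P' n. col P - col P' = 6 * n \<Longrightarrow>
       \<exists>Q Q' i j. in_tile d p q Q \<and> in_tile d p q Q' \<and> P - P' = Q - Q' + l i j \<and> 3 * i + j = 6 * n"
proof -
  have cover: "\<exists>Q. in_tile d p q Q \<and> (\<exists>i j. P = Q + l i j)" for P
    using tiles_cover[OF assms(1-3), of P] unfolding l_def by (metis diff_add_cancel)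
  \<comment> \<open>The representative depends only on the coset of \<open>P\<close>; this makes the colouring equivariant.\<close>
  define rep where "rep P = (SOME Q. in_tile d p q Q \<and> (\<exists>i j. P = Q + l i j))" for P
  have rep: "in_tile d p q (rep P) \<and> (\<exists>i j. P = rep P + l i j)" for P
    using cover[of P] unfolding rep_def by (rule someI_ex)
  have "(\<exists>i' j'. P + l i j = Q + l i' j') \<longleftrightarrow> (\<exists>i' j'. P = Q + l i' j')" for P Q i j
  proof
    assume "\<exists>i' j'. P + l i j = Q + l i' j'"
    then obtain i' j' where "P + l i j = Q + l i' j'" by blast
    then have "P = Q + (l i' j' - l i j)" by (simp add: algebra_simps)
    then show "\<exists>i' j'. P = Q + l i' j'" unfolding l_def lattice_point_diff by blast
  next
    assume "\<exists>i' j'. P = Q + l i' j'"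
    then obtain i' j' where "P = Q + l i' j'" by blast
    then have "P + l i j = Q + (l i' j' + l i j)" by (simp add: algebra_simps)
    then show "\<exists>i' j'. P + l i j = Q + l i' j'" unfolding l_def lattice_point_add by blast
  qed
  then have rep_add: "rep (P + l i j) = rep P" for P i j
    unfolding rep_def by simp
  obtain I J where IJ: "P = rep P + l (I P) (J P)" for P
    using rep by metis
  have inj: "l i j = l i' j' \<longleftrightarrow> i = i' \<and> j = j'" for i j i' j'
    unfolding l_def using assms by (intro lattice_point_eq_iff) auto
  define col where "col P = 3 * I P + J P" for P
  show ?thesis
  proof
    fix P i j
    have "rep P + l (I (P + l i j)) (J (P + l i j)) = P + l i j"
      by (metis IJ rep_add)
    also have "\<dots> = rep P + l (I P + i) (J P + j)"
      by (subst IJ[of P]) (simp add: l_def lattice_point_add[symmetric])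
    finally show "col (P + l i j) = col P + (3 * i + j)"
      by (simp add: inj col_def)
  next
    fix P P' n
    assume "col P - col P' = 6 * n"
    moreover have "P - P' = (rep P + l (I P) (J P)) - (rep P' + l (I P') (J P'))"
      by (simp flip: IJ)
    then have "P - P' = rep P - rep P' + l (I P - I P') (J P - J P')"
      by (simp add: l_def lattice_point_diff[symmetric])
    ultimately show "\<exists>Q Q' i j. in_tile d p q Q \<and> in_tile d p q Q' \<and> P - P' = Q - Q' + l i j \<and> 3 * i + j = 6 * n"
      using rep by (intro exI[of _ "rep P"] exI[of _ "rep P'"] exI[of _ "I P - I P'"] exI[of _ "J P - J P'"])
        (auto simp: col_def)
  qed
qed

subsection \<open>Differences of equally coloured points\<close>

definition facet :: "nat \<Rightarrow> nat \<Rightarrow> real \<times> real \<Rightarrow> real" where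
  "facet k m P = cos (real m * pi / real k) * fst P + sin (real m * pi / real k) * snd P"

lemma facet_add: "facet k m (P + Q) = facet k m P + facet k m Q"
  and facet_diff: "facet k m (P - Q) = facet k m P - facet k m Q"
  by (simp_all add: facet_def algebra_simps)

text \<open>The functional exceeds \<open>1\<close> by more than its maximum over the difference body of the
  hexagon, evaluated at the vertices \<open>(\<plusminus>1/2, d)\<close> and \<open>(p, q)\<close>; hence it exceeds \<open>1\<close> on
  all differences between the tile at \<open>L\<close> and the tile at the origin.\<close>

definition separates :: "nat \<Rightarrow> real \<Rightarrow> real \<Rightarrow> real \<Rightarrow> nat \<Rightarrow> real \<times> real \<Rightarrow> bool" where
  "separates k d p q m L \<longleftrightarrow> 0 < m \<and> m < k \<and>
     facet k m L > 1 + (\<bar>cos (real m * pi / real k)\<bar> + 2 * d * sin (real m * pi / real k)) \<and>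
     facet k m L > 1 + 2 * \<bar>facet k m (p, q)\<bar>"

text \<open>The bound on \<open>d\<close> puts the vertical edges of the hexagon inside the edges of half the
  polygon, and the bound on \<open>p\<^sup>2 + q\<^sup>2\<close> puts \<open>(p, q)\<close> inside its
  inscribed circle. Up to sign and the horizontal direction, the only vectors of the monochromatic sublattice
  that are neither too wide nor two colour periods high are the two listed ones.\<close>

definition admissible :: "nat \<Rightarrow> real \<Rightarrow> real \<Rightarrow> real \<Rightarrow> nat \<Rightarrow> nat \<Rightarrow> bool" where
  "admissible k d p q m m' \<longleftrightarrow> 2 \<le> k \<and> 0 < d \<and> d < q \<and> 0 \<le> p \<and> p < 1/2 \<and>
     4 * real k * d < pi \<and> p\<^sup>2 + q\<^sup>2 < 1/4 \<and>
     separates k d p q m (1/2 + 3 * p, 3 * (d + q)) \<and>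
     separates k d p q m' (3 * p - 3/2, 3 * (d + q)) \<and>
     3 * (d + q) * sin (real m' * pi / real k) > 1"

text \<open>The difference of the two sides vanishes at \<open>0\<close> and has derivative
  \<open>x * sin x\<close>. This is \<open>x \<le> tan x\<close> without the division.\<close>

lemma mult_cos_le_sin:
  fixes x :: real
  assumes "0 \<le> x" "x \<le> pi"
  shows "x * cos x \<le> sin x"
proof -
  have "(\<lambda>x. sin x - x * cos x) 0 \<le> (\<lambda>x. sin x - x * cos x) x"
  proof (rule DERIV_nonneg_imp_nondecreasing[OF assms(1)])
    fix y assume "0 \<le> y" "y \<le> x"
    then show "\<exists>D. ((\<lambda>x. sin x - x * cos x) has_real_derivative D) (at y) \<and> 0 \<le> D"
      using assms(2)
      by (intro exI[of _ "y * sin y"] conjI)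
        (auto intro!: derivative_eq_intros simp: algebra_simps sin_ge_zero)
  qed
  then show ?thesis by simp
qed

text \<open>By half-angle formulas \<open>cos x + 2 * d * sin x < 1\<close> amounts to
  \<open>2 * d < tan (x / 2)\<close>, and \<open>tan (x / 2)\<close> is at least
  \<open>x / 2 \<ge> a / 2\<close>. Replacing \<open>x\<close> by \<open>pi - x\<close> covers
  negative cosines.\<close>

lemma abs_cos_add_sin_less:
  fixes x d :: real
  assumes "a \<le> x" "x \<le> pi - a" "0 < a" "4 * d < a"
  shows "\<bar>cos x\<bar> + 2 * d * sin x < 1"
proof -
  have *: "cos x + 2 * d * sin x < 1" if "a \<le> x" "x \<le> pi - a" for x
  proof -
    define y where "y = x / 2"
    have y: "0 < y" "y < pi / 2" "2 * d < y" using that assms by (auto simp: y_def)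
    have "cos y > 0" "sin y > 0"
      using y by (auto intro!: cos_gt_zero_pi sin_gt_zero)
    have "2 * d * cos y < y * cos y" using y \<open>cos y > 0\<close> by simp
    also have "\<dots> \<le> sin y" using y by (intro mult_cos_le_sin) auto
    finally have "sin y * (2 * d * cos y) < sin y * sin y" using \<open>sin y > 0\<close> by simp
    moreover have "cos x = 1 - 2 * (sin y * sin y)" "sin x = 2 * (sin y * cos y)"
      using cos_double_sin[of y] sin_double[of y] by (simp_all add: y_def power2_eq_square)
    ultimately show ?thesis by (simp add: algebra_simps)
  qed
  from *[of x] *[of "pi - x"] assms show ?thesis by (auto simp: abs_if)
qed

text \<open>Cauchy-Schwarz for a unit normal; the defect is the square of the component orthogonal
  to it.\<close>

lemma facet_square_le:
  "(facet k m (x, y))\<^sup>2 \<le> x\<^sup>2 + y\<^sup>2"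
proof -
  define t where "t = real m * pi / real k"
  have "(cos t * x + sin t * y)\<^sup>2 + (sin t * x - cos t * y)\<^sup>2 = ((sin t)\<^sup>2 + (cos t)\<^sup>2) * (x\<^sup>2 + y\<^sup>2)"
    by algebra
  then have "(cos t * x + sin t * y)\<^sup>2 + (sin t * x - cos t * y)\<^sup>2 = x\<^sup>2 + y\<^sup>2"
    by simp
  then show ?thesis
    using zero_le_power2[of "sin t * x - cos t * y"] unfolding facet_def t_def fst_conv snd_conv
    by linarith
qed

lemma angle_bounds:
  assumes "0 < m" "m < k"
  shows "pi / real k \<le> real m * pi / real k" "real m * pi / real k \<le> pi - pi / real k"
proof -
  have "real m + 1 \<le> real k" using assms by linarith
  then have "(real m + 1) * pi \<le> real k * pi" by (intro mult_right_mono) auto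
  then show "real m * pi / real k \<le> pi - pi / real k" using assms by (simp add: field_simps)
  show "pi / real k \<le> real m * pi / real k" using assms by (simp add: field_simps)
qed

lemma sin_angle_pos:
  assumes "0 < m" "m < k"
  shows "0 < sin (real m * pi / real k)"
proof (rule sin_gt_zero)
  show "0 < real m * pi / real k" using assms by simp
  show "real m * pi / real k < pi" using assms by (simp add: field_simps)
qed

section \<open>Functionals on tiles and on monochromatic differences\<close>

context
  fixes k m m' :: nat and d p q :: real
  assumes adm: "admissible k d p q m m'"
begin

lemma facet_tile_le:
  assumes "hexagon d p q (fst Q) (snd Q)" "0 < n" "n < k"
    and "\<bar>cos (real n * pi / real k)\<bar> + 2 * d * sin (real n * pi / real k) \<le> B" "2 * \<bar>facet k n (p, q)\<bar> \<le> B"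
  shows "\<bar>facet k n Q\<bar> \<le> B / 2"
  unfolding facet_def
proof (rule hexagon_linear_abs_le[OF assms(1)])
  show "0 \<le> sin (real n * pi / real k)" using sin_angle_pos[OF assms(2,3)] by simp
qed (use adm assms(4,5) in \<open>auto simp: admissible_def facet_def algebra_simps\<close>)

text \<open>The tangent estimate with \<open>a = pi / k\<close> handles the vertical edges,
  Cauchy-Schwarz the vertex \<open>(p, q)\<close>. Index \<open>0\<close> must be excluded, since
  \<open>fst Q = 1/2\<close> on the right edge.\<close>

lemma facet_tile_less:
  assumes "hexagon d p q (fst Q) (snd Q)" "0 < n" "n < k"
  shows "\<bar>facet k n Q\<bar> < 1/2"
proof -
  let ?c = "\<bar>cos (real n * pi / real k)\<bar> + 2 * d * sin (real n * pi / real k)"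
  have "4 * d < pi / real k"
    using adm by (simp add: admissible_def field_simps)
  then have c: "?c < 1"
    using adm assms(2,3) angle_bounds[of n k]
    by (intro abs_cos_add_sin_less[of "pi / real k"]) (auto simp: admissible_def)
  have "(facet k n (p, q))\<^sup>2 < (1/2)\<^sup>2"
    using facet_square_le[of k n p q] adm by (simp add: admissible_def power2_eq_square)
  then have b: "2 * \<bar>facet k n (p, q)\<bar> < 1"
    using power2_less_imp_less[of "\<bar>facet k n (p, q)\<bar>" "1/2"] by simp
  have "\<bar>facet k n Q\<bar> \<le> max ?c (2 * \<bar>facet k n (p, q)\<bar>) / 2"
    using assms by (intro facet_tile_le) auto
  also have "\<dots> < 1/2" using b c by simp
  finally show ?thesis .
qed

lemma facet_separated:
  assumes "hexagon d p q (fst Q) (snd Q)" "hexagon d p q (fst Q') (snd Q')"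
    and "separates k d p q n L"
  shows "facet k n (Q - Q' + L) > 1"
proof -
  define B where "B = max (\<bar>cos (real n * pi / real k)\<bar> + 2 * d * sin (real n * pi / real k)) (2 * \<bar>facet k n (p, q)\<bar>)"
  have n: "0 < n" "n < k" using assms(3) by (auto simp: separates_def)
  have "\<bar>facet k n Q\<bar> \<le> B / 2" "\<bar>facet k n Q'\<bar> \<le> B / 2"
    using facet_tile_le[OF assms(1) n, of B] facet_tile_le[OF assms(2) n, of B] by (auto simp: B_def)
  moreover have "facet k n L > 1 + B"
    using assms(3) by (auto simp: separates_def B_def max_def)
  ultimately show ?thesis unfolding facet_add facet_diff by linarith
qed

text \<open>Equal colours recur every third row only, so \<open>j = 3 * t\<close>. For
  \<open>t = 0\<close> the width forces the same tile; for \<open>t = 1\<close> only the two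
  separated lattice vectors remain; for \<open>t \<ge> 2\<close> the height is too large. The last
  two cases contradict \<open>le\<close>.\<close>

lemma same_color_facet_aux:
  assumes tiles: "in_tile d p q Q" "in_tile d p q Q'"
    and D: "D = Q - Q' + lattice_point (1/2 + p) (d + q) i j"
    and "3 * i + j = 6 * n" "0 \<le> j"
    and le: "\<And>r. r < k \<Longrightarrow> \<bar>facet k r D\<bar> \<le> 1"
    and "r < k"
  shows "\<bar>facet k r D\<bar> \<noteq> 1"
proof -
  have hex: "hexagon d p q (fst Q) (snd Q)" "hexagon d p q (fst Q') (snd Q')"
    using tiles by (auto simp: in_tile_def)
  have x: "\<bar>fst Q - fst Q'\<bar> < 1"
    using tiles unfolding in_tile_def hexagon_def by linarith
  define t where "t = 2 * n - i"
  have j: "j = 3 * t" and i: "i = 2 * n - t" and "0 \<le> t"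
    using assms(4,5) by (auto simp: t_def)
  have k: "2 \<le> k" and p: "0 \<le> p" "p < 1/2" and h: "0 < d + q"
    using adm by (auto simp: admissible_def)
  have "\<bar>fst D\<bar> \<le> 1" using le[of 0] k by (simp add: facet_def)
  \<comment> \<open>Strict because \<open>x\<close> is strict; this rules out the vectors
    \<open>(2, 0)\<close> and \<open>(-2, 0)\<close> below.\<close>
  then have x': "\<bar>of_int i + of_int j * (1/2 + p)\<bar> < 2"
    using x by (simp add: D lattice_point_def)
  consider "t = 0" | "t = 1" | "2 \<le> t" using \<open>0 \<le> t\<close> by linarith
  then show ?thesis
  proof cases
    case 1
    then have "\<bar>2 * real_of_int n\<bar> < 2" using x' by (simp add: i j)
    then have "n = 0" by linarith
    then have D: "D = Q - Q'"
      using 1 by (simp add: D i j lattice_point_def zero_prod_def[symmetric])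
    show ?thesis
    proof (cases "r = 0")
      case True
      then show ?thesis using x by (simp add: D facet_def)
    next
      case False
      then have "\<bar>facet k r Q\<bar> < 1/2" "\<bar>facet k r Q'\<bar> < 1/2"
        using \<open>r < k\<close> facet_tile_less[OF hex(1)] facet_tile_less[OF hex(2)] by auto
      then show ?thesis unfolding D facet_diff by linarith
    qed
  next
    case 2
    then have "\<bar>2 * real_of_int n + 1/2 + 3 * p\<bar> < 2" using x' by (simp add: i j algebra_simps)
    then have "2 * real_of_int n < 2" "2 * real_of_int n > - 4" using p by linarith+
    then have "n = 0 \<or> n = - 1" by linarith
    then have "lattice_point (1/2 + p) (d + q) i j = (1/2 + 3 * p, 3 * (d + q)) \<or>
        lattice_point (1/2 + p) (d + q) i j = (3 * p - 3/2, 3 * (d + q))"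
      using 2 by (auto simp: lattice_point_def i j)
    then obtain s where "separates k d p q s (lattice_point (1/2 + p) (d + q) i j)"
      using adm by (auto simp: admissible_def)
    then have "facet k s D > 1" "s < k"
      using facet_separated[OF hex] by (auto simp: D separates_def)
    then show ?thesis using le[of s] by simp
  next
    case 3
    \<comment> \<open>In the sum of the functionals with indices \<open>m'\<close> and \<open>k - m'\<close> the horizontal parts cancel.\<close>
    define S where "S = sin (real m' * pi / real k)"
    define Y where "Y = of_int j * (d + q)"
    have m': "0 < m'" "m' < k" using adm by (auto simp: admissible_def separates_def)
    have "real (k - m') * pi / real k = pi - real m' * pi / real k"
      using m' by (simp add: of_nat_diff field_simps)
    then have "facet k m' (lattice_point (1/2 + p) (d + q) i j) +
        facet k (k - m') (lattice_point (1/2 + p) (d + q) i j) = 2 * (Y * S)"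
      by (simp add: facet_def lattice_point_def S_def Y_def)
    moreover have "\<bar>facet k s (lattice_point (1/2 + p) (d + q) i j)\<bar> \<le> 2" if "0 < s" "s < k" for s
      using le[of s] facet_tile_less[OF hex(1) that] facet_tile_less[OF hex(2) that] that
      unfolding D facet_add facet_diff by linarith
    from this[of m'] this[of "k - m'"] m'
    have "\<bar>facet k m' (lattice_point (1/2 + p) (d + q) i j)\<bar> \<le> 2"
      "\<bar>facet k (k - m') (lattice_point (1/2 + p) (d + q) i j)\<bar> \<le> 2" by auto
    ultimately have "Y * S \<le> 2" by linarith
    moreover have "6 * ((d + q) * S) \<le> of_int j * ((d + q) * S)"
      using 3 h sin_angle_pos[OF m'] by (intro mult_right_mono) (auto simp: S_def j)
    moreover have "3 * (d + q) * S > 1" using adm unfolding admissible_def S_def by blast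
    ultimately show ?thesis by (simp add: Y_def mult.assoc)
  qed
qed

text \<open>Exchanging the two points negates \<open>D\<close> and its lattice vector, so
  \<open>0 \<le> j\<close> may be assumed.\<close>

lemma same_color_facet:
  assumes tiles: "in_tile d p q Q" "in_tile d p q Q'"
    and D: "D = Q - Q' + lattice_point (1/2 + p) (d + q) i j"
    and ij: "3 * i + j = 6 * n"
    and le: "\<And>r. r < k \<Longrightarrow> \<bar>facet k r D\<bar> \<le> 1"
    and "r < k"
  shows "\<bar>facet k r D\<bar> \<noteq> 1"
proof (cases "0 \<le> j")
  case True
  then show ?thesis using same_color_facet_aux[OF tiles D ij] le \<open>r < k\<close> by blast
next
  case False
  have neg: "facet k s (- D) = - facet k s D" for s
    by (simp add: facet_def)
  have "- D = Q' - Q + lattice_point (1/2 + p) (d + q) (- i) (- j)"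
    by (simp add: D lattice_point_def prod_eq_iff)
  moreover have "3 * (- i) + (- j) = 6 * (- n)" "0 \<le> - j" using ij False by auto
  ultimately have "\<bar>facet k r (- D)\<bar> \<noteq> 1"
    using same_color_facet_aux[OF tiles(2,1)] le \<open>r < k\<close> neg by (metis abs_minus_cancel)
  then show ?thesis by (simp add: neg)
qed

end

subsection \<open>The norm of a regular polygon\<close>

text \<open>Rotation by \<open>-\<alpha>\<close> and scaling by \<open>1 / \<rho>\<close>, with
  inverse \<open>point\<close>. For the polygon, \<open>\<rho>\<close> will be the inradius and
  \<open>\<alpha>\<close> the direction of an edge normal.\<close>

definition coords :: "real \<Rightarrow> real \<Rightarrow> real^2 \<Rightarrow> real \<times> real" where
  "coords \<rho> \<alpha> P = ((cos \<alpha> * P$1 + sin \<alpha> * P$2) / \<rho>, (cos \<alpha> * P$2 - sin \<alpha> * P$1) / \<rho>)"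

definition point :: "real \<Rightarrow> real \<Rightarrow> real \<times> real \<Rightarrow> real^2" where
  "point \<rho> \<alpha> Q = vector [\<rho> * (cos \<alpha> * fst Q - sin \<alpha> * snd Q), \<rho> * (sin \<alpha> * fst Q + cos \<alpha> * snd Q)]"

lemma coords_add: "coords \<rho> \<alpha> (P + Q) = coords \<rho> \<alpha> P + coords \<rho> \<alpha> Q"
  and coords_diff: "coords \<rho> \<alpha> (P - Q) = coords \<rho> \<alpha> P - coords \<rho> \<alpha> Q"
  and coords_scaleR: "coords \<rho> \<alpha> (c *\<^sub>R P) = c *\<^sub>R coords \<rho> \<alpha> P"
  by (simp_all add: coords_def add_divide_distrib diff_divide_distrib algebra_simps)

lemma coords_point:
  assumes "\<rho> > 0"
  shows "coords \<rho> \<alpha> (point \<rho> \<alpha> Q) = Q"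
proof -
  have "cos \<alpha> * (\<rho> * (cos \<alpha> * fst Q - sin \<alpha> * snd Q)) + sin \<alpha> * (\<rho> * (sin \<alpha> * fst Q + cos \<alpha> * snd Q))
      = ((sin \<alpha>)\<^sup>2 + (cos \<alpha>)\<^sup>2) * (\<rho> * fst Q)"
    by algebra
  moreover have "cos \<alpha> * (\<rho> * (sin \<alpha> * fst Q + cos \<alpha> * snd Q)) - sin \<alpha> * (\<rho> * (cos \<alpha> * fst Q - sin \<alpha> * snd Q))
      = ((sin \<alpha>)\<^sup>2 + (cos \<alpha>)\<^sup>2) * (\<rho> * snd Q)"
    by algebra
  ultimately show ?thesis
    using assms by (simp add: coords_def point_def prod_eq_iff)
qed

lemma facet_scaleR: "facet k m (c *\<^sub>R P) = c * facet k m P"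
  by (simp add: facet_def algebra_simps)

definition height :: "real \<Rightarrow> real^2 \<Rightarrow> real" where
  "height t P = cos t * P$1 + sin t * P$2"

lemma facet_coords:
  "facet k m (coords \<rho> \<alpha> P) = height (\<alpha> + real m * pi / real k) P / \<rho>"
  by (simp add: facet_def coords_def height_def cos_add sin_add field_simps diff_divide_distrib add_divide_distrib)

lemma height_add: "height t (P + Q) = height t P + height t Q"
  and height_scaleR: "height t (c *\<^sub>R P) = c * height t P"
  by (simp_all add: height_def algebra_simps)

lemma abs_cos_add_int_pi: "\<bar>cos (t + of_int n * pi)\<bar> = \<bar>cos t\<bar>"
proof -
  have "sin (of_int n * pi) = 0" by (simp add: mult.commute)
  moreover from this have "\<bar>cos (of_int n * pi)\<bar> = 1"
    using sin_cos_squared_add[of "of_int n * pi"] by (auto simp: power2_eq_1_iff)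
  ultimately show ?thesis by (simp add: cos_add abs_mult)
qed

lemma abs_height_add_int_pi: "\<bar>height (t + of_int n * pi) P\<bar> = \<bar>height t P\<bar>"
proof -
  have "sin (of_int n * pi) = 0" by (simp add: mult.commute)
  moreover from this have "\<bar>cos (of_int n * pi)\<bar> = 1"
    using abs_cos_add_int_pi[of 0 n] by simp
  moreover have "height (t + of_int n * pi) P = cos (of_int n * pi) * height t P" if "sin (of_int n * pi) = 0"
    using that by (simp add: height_def cos_add sin_add algebra_simps)
  ultimately show ?thesis by (simp add: abs_mult)
qed

text \<open>An odd multiple of \<open>pi / (2 * k)\<close> stays at least
  \<open>pi / (2 * k)\<close> away from every multiple of \<open>pi\<close>. Such angles occur
  between edge normals and vertices.\<close>

lemma abs_cos_odd_le:
  assumes "k > 0" "odd z"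
  shows "\<bar>cos (of_int z * pi / (2 * real k))\<bar> \<le> cos (pi / (2 * real k))"
proof -
  define a where "a = pi / (2 * real k)"
  define w where "w = z mod (2 * int k)"
  have k: "real k > 0" using assms by simp
  \<comment> \<open>The modulus is even, so \<open>w\<close> is odd like \<open>z\<close> and cannot
    be \<open>0\<close>.\<close>
  have "z = w + 2 * (int k * (z div (2 * int k)))"
    unfolding w_def by (metis mod_mult_div_eq mult.assoc)
  then have "odd w" using assms(2) by (metis dvd_triv_left even_add)
  moreover have "0 \<le> w" "w < 2 * int k" using assms(1) by (auto simp: w_def)
  ultimately have w: "1 \<le> w" "w \<le> 2 * int k - 1"
    by (auto simp: le_less)
  have "of_int z = of_int (z div (2 * int k)) * (2 * real k) + of_int w"
    unfolding w_def by (metis (mono_tags) div_mult_mod_eq of_int_add of_int_mult of_int_of_nat_eq of_int_numeral)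
  then have "of_int z * pi / (2 * real k) = of_int w * a + of_int (z div (2 * int k)) * pi"
    using k by (simp add: a_def field_simps)
  then have *: "\<bar>cos (of_int z * pi / (2 * real k))\<bar> = \<bar>cos (of_int w * a)\<bar>"
    using abs_cos_add_int_pi by simp
  have a: "0 < a" "2 * real k * a = pi" using k by (auto simp: a_def)
  have "1 \<le> real_of_int w" "real_of_int w \<le> 2 * real k - 1" using w by linarith+
  then have "1 * a \<le> of_int w * a" "of_int w * a \<le> (2 * real k - 1) * a"
    using a(1) by (auto intro!: mult_right_mono)
  then have x: "a \<le> of_int w * a" "of_int w * a \<le> pi - a"
    using a(2) by (simp_all add: algebra_simps)
  have "cos (of_int w * a) \<le> cos a"
    using x a by (intro cos_monotone_0_pi_le) auto
  moreover have "cos (pi - of_int w * a) \<le> cos a"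
    using x a by (intro cos_monotone_0_pi_le) auto
  ultimately show ?thesis unfolding * a_def[symmetric] by auto
qed

lemma polar_real2:
  obtains s \<psi> where "s \<ge> 0" "P$1 = s * cos \<psi>" "P$2 = s * sin (\<psi>::real)"
proof -
  have "rcis (cmod (Complex (P$1) (P$2))) (Arg (Complex (P$1) (P$2))) = Complex (P$1) (P$2)"
    by (rule rcis_cmod_Arg)
  then show ?thesis
    by (intro that[of "cmod (Complex (P$1) (P$2))" "Arg (Complex (P$1) (P$2))"])
      (metis norm_ge_zero, metis Re_rcis complex.sel(1), metis Im_rcis complex.sel(2))
qed

text \<open>One inclusion holds since the vertices satisfy the inequalities and these define a
  convex set. For the other, a point lies in the sector of two adjacent vertices, and the inequality
  of the edge between them bounds the sum of its coefficients by \<open>1\<close>.\<close>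

lemma regular_polygon_eq:
  assumes "regular_polygon (2 * k) 0 C"
  obtains \<rho> \<alpha> where "\<rho> > 0" "C = {P. \<forall>m<k. \<bar>facet k m (coords \<rho> \<alpha> P)\<bar> \<le> 1}"
proof -
  obtain r \<theta> where k: "2 * k \<ge> 3" and r: "r > 0" and C: "C = convex hull
        ((\<lambda>j. 0 + r *\<^sub>R vector [cos (\<theta> + 2 * pi * real j / real (2 * k)),
                               sin (\<theta> + 2 * pi * real j / real (2 * k))]) ` {..<2 * k})"
    using assms unfolding regular_polygon_def by auto
  define \<beta> where "\<beta> = pi / real k"
  define \<rho> where "\<rho> = r * cos (\<beta> / 2)"
  define \<alpha> where "\<alpha> = \<theta> + \<beta> / 2"
  \<comment> \<open>Integer indices with period \<open>2 * k\<close> avoid a separate case for the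
    edge closing the polygon.\<close>
  define v :: "int \<Rightarrow> real^2" where "v j = r *\<^sub>R vector [cos (\<theta> + of_int j * \<beta>), sin (\<theta> + of_int j * \<beta>)]" for j
  have k0: "real k > 0" "k > 0" and k2: "k \<ge> 2" using k by auto
  have \<beta>: "\<beta> > 0" "real k * \<beta> = pi" "\<beta> \<le> pi / 2"
    using k0 k2 by (auto simp: \<beta>_def field_simps)
  have cos_pos: "cos (\<beta> / 2) > 0" using \<beta> by (intro cos_gt_zero_pi) auto
  have \<rho>: "\<rho> > 0" using r cos_pos by (simp add: \<rho>_def)
  have v_in: "v (int j) \<in> C" if "j < 2 * k" for j
    unfolding C
    by (rule hull_inc, rule image_eqI[of _ _ j]) (use that in \<open>auto simp: v_def \<beta>_def field_simps\<close>)
  have v_period: "v (j + 2 * int k * n) = v j" for j n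
  proof -
    have "\<theta> + of_int (j + 2 * int k * n) * \<beta> = \<theta> + of_int j * \<beta> + of_int n * (2 * (real k * \<beta>))"
      by (simp add: algebra_simps)
    also have "\<dots> = (\<theta> + of_int j * \<beta>) + 2 * pi * of_int n" unfolding \<beta>(2) by simp
    finally have eq: "\<theta> + of_int (j + 2 * int k * n) * \<beta> = (\<theta> + of_int j * \<beta>) + 2 * pi * of_int n" .
    show ?thesis
      unfolding v_def eq by (simp add: cos_add sin_add)
  qed
  have v_in_int: "v j \<in> C" for j
  proof -
    have "v j = v (j mod (2 * int k) + 2 * int k * (j div (2 * int k)))" by simp
    also have "\<dots> = v (int (nat (j mod (2 * int k))))" unfolding v_period using k0 by simp
    also have "\<dots> \<in> C" using k0 by (intro v_in) (simp add: nat_less_iff)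
    finally show ?thesis .
  qed
  have "convex C" unfolding C by (rule convex_convex_hull)
  have "v (int k) = - v 0"
    by (simp add: v_def \<beta> vec_eq_iff forall_2)
  then have "0 = (1/2) *\<^sub>R v 0 + (1/2) *\<^sub>R v (int k)" by simp
  also have "\<dots> \<in> C" by (rule convexD[OF \<open>convex C\<close>]) (auto simp: v_in_int)
  finally have zero: "0 \<in> C" .
  have height_v: "height (\<alpha> + of_int m * \<beta>) (v j) = r * cos (of_int (2 * m + 1 - 2 * j) * pi / (2 * real k))" for m j
  proof -
    have "height (\<alpha> + of_int m * \<beta>) (v j) = r * cos ((\<alpha> + of_int m * \<beta>) - (\<theta> + of_int j * \<beta>))"
      by (simp add: height_def v_def cos_diff algebra_simps)
    also have "(\<alpha> + of_int m * \<beta>) - (\<theta> + of_int j * \<beta>) = of_int (2 * m + 1 - 2 * j) * pi / (2 * real k)"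
      using k0 by (simp add: \<alpha>_def \<beta>_def field_simps)
    finally show ?thesis .
  qed
  define K where "K = {P. \<forall>m<k. \<bar>facet k m (coords \<rho> \<alpha> P)\<bar> \<le> 1}"
  have K: "P \<in> K \<longleftrightarrow> (\<forall>m<k. \<bar>height (\<alpha> + real m * \<beta>) P\<bar> \<le> \<rho>)" for P
    using \<rho> by (simp add: K_def facet_coords \<beta>_def)
  have "C \<subseteq> K"
    unfolding C
  proof (rule hull_minimal)
    have "(0 + r *\<^sub>R vector [cos (\<theta> + 2 * pi * real j / real (2 * k)), sin (\<theta> + 2 * pi * real j / real (2 * k))]) \<in> K" for j
    proof -
      have "(0 + r *\<^sub>R vector [cos (\<theta> + 2 * pi * real j / real (2 * k)), sin (\<theta> + 2 * pi * real j / real (2 * k))]) = v (int j)"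
        using k0 by (simp add: v_def \<beta>_def field_simps)
      moreover have "\<bar>height (\<alpha> + of_int (int m) * \<beta>) (v (int j))\<bar> \<le> \<rho>" for m
      proof -
        have "\<bar>height (\<alpha> + of_int (int m) * \<beta>) (v (int j))\<bar>
            = r * \<bar>cos (of_int (2 * int m + 1 - 2 * int j) * pi / (2 * real k))\<bar>"
          unfolding height_v abs_mult using r by simp
        also have "\<dots> \<le> r * cos (pi / (2 * real k))"
          using r by (intro mult_left_mono abs_cos_odd_le k0) auto
        also have "\<dots> = \<rho>" by (simp add: \<rho>_def \<beta>_def mult.commute)
        finally show ?thesis .
      qed
      ultimately show ?thesis by (simp add: K)
    qed
    then show "(\<lambda>j. 0 + r *\<^sub>R vector [cos (\<theta> + 2 * pi * real j / real (2 * k)),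
                               sin (\<theta> + 2 * pi * real j / real (2 * k))]) ` {..<2 * k} \<subseteq> K"
      by blast
    show "convex K"
    proof (rule convexI)
      fix P Q :: "real^2" and a b :: real
      assume *: "P \<in> K" "Q \<in> K" "0 \<le> a" "0 \<le> b" "a + b = 1"
      have "\<bar>height t (a *\<^sub>R P + b *\<^sub>R Q)\<bar> \<le> \<rho>" if "\<bar>height t P\<bar> \<le> \<rho>" "\<bar>height t Q\<bar> \<le> \<rho>" for t
      proof -
        have "\<bar>height t (a *\<^sub>R P + b *\<^sub>R Q)\<bar> \<le> a * \<bar>height t P\<bar> + b * \<bar>height t Q\<bar>"
          using * abs_triangle_ineq[of "a * height t P" "b * height t Q"]
          by (simp add: height_add height_scaleR abs_mult)
        also have "\<dots> \<le> a * \<rho> + b * \<rho>" using * that by (intro add_mono mult_left_mono) auto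
        also have "\<dots> = \<rho>" using *(5) by (simp flip: distrib_right)
        finally show ?thesis .
      qed
      then show "a *\<^sub>R P + b *\<^sub>R Q \<in> K" using * unfolding K by blast
    qed
  qed
  moreover have "P \<in> C" if "P \<in> K" for P
  proof -
    obtain s \<psi> where s: "s \<ge> 0" and P: "P$1 = s * cos \<psi>" "P$2 = s * sin \<psi>"
      by (rule polar_real2)
    define j where "j = \<lfloor>(\<psi> - \<theta>) / \<beta>\<rfloor>"
    define a where "a = \<theta> + of_int j * \<beta>"
    define \<delta> where "\<delta> = \<psi> - a"
    have "of_int j \<le> (\<psi> - \<theta>) / \<beta>" "(\<psi> - \<theta>) / \<beta> < of_int j + 1"
      unfolding j_def by linarith+
    then have \<delta>: "0 \<le> \<delta>" "\<delta> \<le> \<beta>"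
      using \<beta>(1) by (auto simp: \<delta>_def a_def field_simps)
    have "\<bar>height (\<alpha> + of_int j * \<beta>) P\<bar> \<le> \<rho>"
    proof -
      \<comment> \<open>Only \<open>k\<close> normals are listed; a shift of the index by
        \<open>k\<close> is a half turn, absorbed by the absolute value.\<close>
      have "of_int j = of_int (j mod int k) + of_int (j div int k) * real k"
        by (metis mod_mult_div_eq mult.commute of_int_add of_int_mult of_int_of_nat_eq)
      then have "\<alpha> + of_int j * \<beta> = (\<alpha> + of_int (j mod int k) * \<beta>) + of_int (j div int k) * (real k * \<beta>)"
        by (simp add: algebra_simps)
      then have "\<bar>height (\<alpha> + of_int j * \<beta>) P\<bar> = \<bar>height (\<alpha> + of_int (j mod int k) * \<beta>) P\<bar>"
        unfolding \<beta>(2) by (simp only: abs_height_add_int_pi)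
      also have "of_int (j mod int k) = real (nat (j mod int k))" using k0 by simp
      also have "\<bar>height (\<alpha> + real (nat (j mod int k)) * \<beta>) P\<bar> \<le> \<rho>"
      proof -
        have "nat (j mod int k) < k" using k0 by (simp add: nat_less_iff)
        then show ?thesis using that unfolding K by blast
      qed
      finally show ?thesis .
    qed
    moreover have "height (\<alpha> + of_int j * \<beta>) P = s * cos (\<alpha> + of_int j * \<beta> - \<psi>)"
      by (simp add: height_def P cos_diff algebra_simps)
    moreover have "\<alpha> + of_int j * \<beta> - \<psi> = \<beta> / 2 - \<delta>" by (simp add: \<alpha>_def \<delta>_def a_def)
    ultimately have le: "s * cos (\<beta> / 2 - \<delta>) \<le> \<rho>" by (simp add: abs_le_iff)
    have sin_pos: "sin \<beta> > 0" using \<beta> by (intro sin_gt_zero) auto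
    \<comment> \<open>Cramer's rule for expressing \<open>P\<close> through the vertices
      \<open>v j\<close> and \<open>v (j + 1)\<close>.\<close>
    define l where "l = s * sin (\<beta> - \<delta>) / (r * sin \<beta>)"
    define m where "m = s * sin \<delta> / (r * sin \<beta>)"
    have "0 \<le> l" "0 \<le> m"
      using s r \<delta> \<beta> sin_pos by (auto simp: l_def m_def intro!: divide_nonneg_pos mult_nonneg_nonneg sin_ge_zero)
    have "sin (\<beta> - \<delta>) + sin \<delta> = 2 * sin (\<beta> / 2) * cos (\<beta> / 2 - \<delta>)"
      using sin_plus_sin[of "\<beta> - \<delta>" \<delta>] by (simp add: diff_divide_distrib)
    moreover have "sin \<beta> = 2 * sin (\<beta> / 2) * cos (\<beta> / 2)"
      using sin_double[of "\<beta> / 2"] by simp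
    moreover have "sin (\<beta> / 2) > 0" using \<beta> by (intro sin_gt_zero) auto
    ultimately have "l + m = s * cos (\<beta> / 2 - \<delta>) / \<rho>"
      using r cos_pos unfolding l_def m_def \<rho>_def add_divide_distrib[symmetric] distrib_left[symmetric]
      by (simp add: field_simps)
    then have "l + m \<le> 1" using le \<rho> by simp
    have "cos \<psi> * sin \<beta> = sin (\<beta> - \<delta>) * cos a + sin \<delta> * cos (a + \<beta>)"
         "sin \<psi> * sin \<beta> = sin (\<beta> - \<delta>) * sin a + sin \<delta> * sin (a + \<beta>)"
    proof -
      have \<psi>: "\<psi> = a + \<delta>" by (simp add: \<delta>_def)
      show "cos \<psi> * sin \<beta> = sin (\<beta> - \<delta>) * cos a + sin \<delta> * cos (a + \<beta>)"
           "sin \<psi> * sin \<beta> = sin (\<beta> - \<delta>) * sin a + sin \<delta> * sin (a + \<beta>)"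
        unfolding \<psi> cos_add sin_add sin_diff by algebra+
    qed
    then have trig: "cos \<psi> = (sin (\<beta> - \<delta>) * cos a + sin \<delta> * cos (a + \<beta>)) / sin \<beta>"
         "sin \<psi> = (sin (\<beta> - \<delta>) * sin a + sin \<delta> * sin (a + \<beta>)) / sin \<beta>"
      using sin_pos by (simp_all add: field_simps)
    have "\<theta> + of_int (j + 1) * \<beta> = a + \<beta>" by (simp add: a_def algebra_simps)
    then have vj: "v j = r *\<^sub>R vector [cos a, sin a]" "v (j + 1) = r *\<^sub>R vector [cos (a + \<beta>), sin (a + \<beta>)]"
      by (simp_all only: v_def a_def)
    have "P = l *\<^sub>R v j + m *\<^sub>R v (j + 1)"
      unfolding vec_eq_iff forall_2 P trig vj
      using r sin_pos by (simp add: l_def m_def field_simps)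
    also have "\<dots> \<in> C"
    proof (cases "l + m = 0")
      case True
      then have "l = 0" "m = 0" using \<open>0 \<le> l\<close> \<open>0 \<le> m\<close> by linarith+
      then show ?thesis using zero by simp
    next
      case False
      then have pos: "l + m > 0" using \<open>0 \<le> l\<close> \<open>0 \<le> m\<close> by simp
      have "(l / (l + m)) *\<^sub>R v j + (m / (l + m)) *\<^sub>R v (j + 1) \<in> C"
        using \<open>0 \<le> l\<close> \<open>0 \<le> m\<close> pos
        by (intro convexD[OF \<open>convex C\<close>] v_in_int) (auto simp flip: add_divide_distrib)
      \<comment> \<open>Since \<open>l + m\<close> may be less than \<open>1\<close>,
        \<open>P\<close> is a convex combination of \<open>0\<close> and the point \<open>w\<close>
        of the edge.\<close>
      moreover define w where "w = (l / (l + m)) *\<^sub>R v j + (m / (l + m)) *\<^sub>R v (j + 1)"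
      ultimately have "(l + m) *\<^sub>R w + (1 - (l + m)) *\<^sub>R 0 \<in> C"
        using zero pos \<open>l + m \<le> 1\<close> by (intro convexD[OF \<open>convex C\<close>]) auto
      then show ?thesis using False by (simp add: scaleR_add_right w_def)
    qed
    finally show ?thesis .
  qed
  ultimately have "C = K" by blast
  then show ?thesis using that \<rho> K_def by blast
qed

text \<open>The admissible scalings are the positive \<open>t\<close> that are at least the maximum
  \<open>M\<close> of the absolute values, so norm \<open>1\<close> forces
  \<open>M = 1\<close>.\<close>

lemma C_norm_eq_1:
  assumes C: "C = {P. \<forall>m<k. \<bar>f m P\<bar> \<le> (1::real)}" and "k > (0::nat)"
    and f: "\<And>m c P. f m (c *\<^sub>R P) = c * f m P"
    and norm: "C_norm C P = 1"
  shows "\<forall>m<k. \<bar>f m P\<bar> \<le> 1" "\<exists>m<k. \<bar>f m P\<bar> = 1"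
proof -
  define T where "T = {t. t > 0 \<and> P \<in> (\<lambda>y. t *\<^sub>R y) ` C}"
  have T: "t \<in> T \<longleftrightarrow> t > 0 \<and> (\<forall>m<k. \<bar>f m P\<bar> \<le> t)" for t
  proof (cases "t > 0")
    case True
    have "P \<in> (\<lambda>y. t *\<^sub>R y) ` C \<longleftrightarrow> (1 / t) *\<^sub>R P \<in> C"
      using True by (auto simp: image_iff intro!: bexI[of _ "(1/t) *\<^sub>R P"])
    also have "\<dots> \<longleftrightarrow> (\<forall>m<k. \<bar>f m P\<bar> \<le> t)"
      unfolding C using True by (simp add: f abs_mult field_simps)
    finally show ?thesis using True by (simp add: T_def)
  qed (simp add: T_def)
  have Inf: "Inf T = 1" using norm by (simp add: C_norm_def T_def)
  have bdd: "bdd_below T" by (rule bdd_belowI[of _ 0]) (simp add: T)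
  define M where "M = Max ((\<lambda>m. \<bar>f m P\<bar>) ` {..<k})"
  have M: "\<bar>f m P\<bar> \<le> M" if "m < k" for m
    unfolding M_def using that by (intro Max_ge) auto
  have "M \<in> (\<lambda>m. \<bar>f m P\<bar>) ` {..<k}"
    unfolding M_def using \<open>k > 0\<close> by (intro Max_in) auto
  then obtain m where m: "m < k" "\<bar>f m P\<bar> = M" by auto
  \<comment> \<open>The value \<open>1/2\<close> keeps the scaling positive if \<open>M = 0\<close>
    and is too small to be the infimum \<open>1\<close>.\<close>
  have "max M (1/2) \<in> T" using M by (auto simp: T le_max_iff_disj)
  then have "1 \<le> max M (1/2)" using cInf_lower[OF _ bdd] Inf by metis
  then have "1 \<le> M" by simp
  moreover have "M \<le> 1"
    unfolding Inf[symmetric]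
  proof (rule cInf_greatest)
    show "T \<noteq> {}" using \<open>max M (1/2) \<in> T\<close> by blast
  qed (use m in \<open>auto simp: T\<close>)
  ultimately show "\<forall>m<k. \<bar>f m P\<bar> \<le> 1" "\<exists>m<k. \<bar>f m P\<bar> = 1"
    using M m by auto
qed

subsection \<open>Numerical verification\<close>

definition cos_poly :: "real \<Rightarrow> real" where
  "cos_poly x = 1 - x^2/2 + x^4/24 - x^6/720 + x^8/40320 - x^10/3628800 + x^12/479001600"

definition sin_poly :: "real \<Rightarrow> real" where
  "sin_poly x = x - x^3/6 + x^5/120 - x^7/5040 + x^9/362880 - x^11/39916800 + x^13/6227020800"

text \<open>Lagrange remainder of order 14. The range suffices for indices
  \<open>m \<le> 3 * k / 4\<close>, as \<open>3/4 * 3.1416 < 5/2\<close>.\<close>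

lemma abs_diff_cos_poly_le:
  assumes "\<bar>x\<bar> \<le> 5/2"
  shows "\<bar>cos x - cos_poly x\<bar> \<le> 1/100000"
proof -
  obtain t where "cos x = (\<Sum>m<14. cos_coeff m * x ^ m) + cos (t + 1/2 * real 14 * pi) / fact 14 * x ^ 14"
    using Maclaurin_cos_expansion[of x 14] by blast
  moreover have "(\<Sum>m<14. cos_coeff m * x ^ m) = cos_poly x"
    by (simp add: cos_poly_def cos_coeff_def lessThan_nat_numeral fact_numeral)
  moreover have "\<bar>cos (t + 1/2 * real 14 * pi) / fact 14 * x ^ 14\<bar> \<le> 1 / fact 14 * (5/2) ^ 14"
    unfolding abs_mult abs_divide power_abs using assms by (intro mult_mono divide_mono power_mono) auto
  moreover have "1 / fact 14 * (5/2) ^ 14 \<le> (1/100000 :: real)"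
    by (simp add: fact_numeral power_divide)
  ultimately show ?thesis by linarith
qed

lemma abs_diff_sin_poly_le:
  assumes "\<bar>x\<bar> \<le> 5/2"
  shows "\<bar>sin x - sin_poly x\<bar> \<le> 1/100000"
proof -
  obtain t where "sin x = (\<Sum>m<15. sin_coeff m * x ^ m) + sin (t + 1/2 * real 15 * pi) / fact 15 * x ^ 15"
    using Maclaurin_sin_expansion[of x 15] by blast
  moreover have "(\<Sum>m<15. sin_coeff m * x ^ m) = sin_poly x"
    by (simp add: sin_poly_def sin_coeff_def lessThan_nat_numeral fact_numeral)
  moreover have "\<bar>sin (t + 1/2 * real 15 * pi) / fact 15 * x ^ 15\<bar> \<le> 1 / fact 15 * (5/2) ^ 15"
    unfolding abs_mult abs_divide power_abs using assms by (intro mult_mono divide_mono power_mono) auto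
  moreover have "1 / fact 15 * (5/2) ^ 15 \<le> (1/100000 :: real)"
    by (simp add: fact_numeral power_divide)
  ultimately show ?thesis by linarith
qed

lemma abs_cos_diff_le: "\<bar>cos x - cos y\<bar> \<le> \<bar>x - y\<bar>" for x y :: real
proof -
  have "\<bar>cos x - cos y\<bar> = 2 * (\<bar>sin ((x + y) / 2)\<bar> * \<bar>sin ((y - x) / 2)\<bar>)"
    by (simp add: cos_diff_cos abs_mult)
  also have "\<dots> \<le> 2 * (1 * \<bar>(y - x) / 2\<bar>)"
    by (intro mult_left_mono mult_mono abs_sin_x_le_abs_x) auto
  finally show ?thesis by simp
qed

lemma abs_sin_diff_le: "\<bar>sin x - sin y\<bar> \<le> \<bar>x - y\<bar>" for x y :: real
  using abs_cos_diff_le[of "pi/2 - x" "pi/2 - y"] by (simp add: cos_diff abs_minus_commute)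

text \<open>The constant \<open>3927/1250 = 3.1416\<close> approximates \<open>pi\<close>.\<close>

lemma angle_approx:
  assumes "4 * m \<le> 3 * k" "0 < k"
  defines "y \<equiv> 3927/1250 * real m / real k"
  shows "\<bar>cos_poly y - c\<bar> \<le> 1/20000 \<Longrightarrow> \<bar>cos (real m * pi / real k) - c\<bar> \<le> 1/10000"
    and "\<bar>sin_poly y - c\<bar> \<le> 1/20000 \<Longrightarrow> \<bar>sin (real m * pi / real k) - c\<bar> \<le> 1/10000"
proof -
  have "4 * real m \<le> 3 * real k" using assms(1) by linarith
  then have mk: "real m / real k \<le> 3/4" using assms(2) by (simp add: field_simps)
  have y: "y = 3927/1250 * (real m / real k)" by (simp add: y_def)
  have "\<bar>y\<bar> \<le> 5/2" using mk by (simp add: y)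
  have "real m * pi / real k - y = (pi - 3927/1250) * (real m / real k)"
    by (simp add: y algebra_simps)
  moreover have "\<bar>pi - 3927/1250\<bar> \<le> 1/100000" using pi_approx by (simp add: abs_le_iff)
  ultimately have "\<bar>real m * pi / real k - y\<bar> \<le> 1/100000 * (3/4)"
    using mk by (simp only: abs_mult) (intro mult_mono, auto)
  then have *: "\<bar>real m * pi / real k - y\<bar> \<le> 1/100000" by simp
  \<comment> \<open>Error budget: \<open>1/100000\<close> each for the Taylor polynomial and the
    angle, and \<open>1/20000\<close> for the decimal \<open>c\<close>.\<close>
  show "\<bar>cos (real m * pi / real k) - c\<bar> \<le> 1/10000" if "\<bar>cos_poly y - c\<bar> \<le> 1/20000"
    using abs_diff_cos_poly_le[OF \<open>\<bar>y\<bar> \<le> 5/2\<close>] abs_cos_diff_le[of "real m * pi / real k" y] * that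
    by linarith
  show "\<bar>sin (real m * pi / real k) - c\<bar> \<le> 1/10000" if "\<bar>sin_poly y - c\<bar> \<le> 1/20000"
    using abs_diff_sin_poly_le[OF \<open>\<bar>y\<bar> \<le> 5/2\<close>] abs_sin_diff_le[of "real m * pi / real k" y] * that
    by linarith
qed

text \<open>Errors of \<open>1/10000\<close> in cosine and sine change the right-hand sides by at
  most \<open>5/10000\<close> and the left-hand sides by at most \<open>2/10000\<close>, within the
  margin \<open>1/1000\<close>.\<close>

lemma separatesI:
  assumes "0 < m" "4 * m \<le> 3 * k"
    and "\<bar>cos_poly (3927/1250 * real m / real k) - c\<bar> \<le> 1/20000"
    and "\<bar>sin_poly (3927/1250 * real m / real k) - s\<bar> \<le> 1/20000"
    and "1 + (\<bar>c\<bar> + 2 * d * s) + 1/1000 < c * x + s * y"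
    and "1 + 2 * \<bar>c * p + s * q\<bar> + 1/1000 < c * x + s * y"
    and "\<bar>x\<bar> \<le> 2" "\<bar>y\<bar> \<le> 3" "\<bar>d\<bar> \<le> 1/2" "\<bar>p\<bar> \<le> 1/2" "\<bar>q\<bar> \<le> 1/2"
  shows "separates k d p q m (x, y)"
proof -
  define c' where "c' = cos (real m * pi / real k)"
  define s' where "s' = sin (real m * pi / real k)"
  have k: "0 < k" "m < k" using assms(1,2) by auto
  have c: "\<bar>c' - c\<bar> \<le> 1/10000" and s: "\<bar>s' - s\<bar> \<le> 1/10000"
    using angle_approx[OF assms(2) k(1)] assms(3,4) by (auto simp: c'_def s'_def)
  have prod: "\<bar>e * z\<bar> \<le> 1/10000 * b" if "\<bar>e\<bar> \<le> 1/10000" "\<bar>z\<bar> \<le> b" for e z b :: real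
    using that unfolding abs_mult by (intro mult_mono) auto
  have "\<bar>c' * x - c * x\<bar> \<le> 1/10000 * 2" "\<bar>s' * y - s * y\<bar> \<le> 1/10000 * 3"
    and d: "\<bar>s' * d - s * d\<bar> \<le> 1/10000 * (1/2)"
    and "\<bar>c' * p - c * p\<bar> \<le> 1/10000 * (1/2)" "\<bar>s' * q - s * q\<bar> \<le> 1/10000 * (1/2)"
    unfolding left_diff_distrib[symmetric]
    by (rule prod[OF c assms(7)] prod[OF s assms(8)] prod[OF s assms(9)] prod[OF c assms(10)]
        prod[OF s assms(11)])+
  then have pq: "\<bar>c' * p + s' * q\<bar> \<le> \<bar>c * p + s * q\<bar> + 1/10000"
    and xy: "c * x + s * y \<le> c' * x + s' * y + 5/10000"
    by linarith+
  have c_abs: "\<bar>c'\<bar> \<le> \<bar>c\<bar> + 1/10000" using c by linarith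
  have d': "2 * d * s' \<le> 2 * d * s + 1/10000"
  proof -
    have "2 * d * s' = 2 * (s' * d)" "2 * d * s = 2 * (s * d)" by simp_all
    then show ?thesis using d by linarith
  qed
  have "1 + (\<bar>c'\<bar> + 2 * d * s') < c' * x + s' * y" "1 + 2 * \<bar>c' * p + s' * q\<bar> < c' * x + s' * y"
    using c_abs d' pq xy assms(5,6) [[linarith_split_limit = 0]] by linarith+
  then show ?thesis
    using assms(1) k by (simp add: separates_def facet_def c'_def s'_def)
qed

text \<open>Every premise is an inequality between rationals once the parameters are numerals;
  \<open>3141/1000\<close> stands in for \<open>pi\<close> from below.\<close>

lemma admissibleI:
  assumes "2 \<le> k" "0 < d" "d < q" "0 \<le> p" "p < 1/2" "4 * real k * d \<le> 3141/1000" "p\<^sup>2 + q\<^sup>2 < 1/4"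
    and "0 < m" "4 * m \<le> 3 * k" "0 < m'" "4 * m' \<le> 3 * k"
    and "\<bar>cos_poly (3927/1250 * real m / real k) - c\<bar> \<le> 1/20000"
    and "\<bar>sin_poly (3927/1250 * real m / real k) - s\<bar> \<le> 1/20000"
    and "\<bar>cos_poly (3927/1250 * real m' / real k) - c'\<bar> \<le> 1/20000"
    and "\<bar>sin_poly (3927/1250 * real m' / real k) - s'\<bar> \<le> 1/20000"
    and "1 + (\<bar>c\<bar> + 2 * d * s) + 1/1000 < c * (1/2 + 3 * p) + s * (3 * (d + q))"
    and "1 + 2 * \<bar>c * p + s * q\<bar> + 1/1000 < c * (1/2 + 3 * p) + s * (3 * (d + q))"
    and "1 + (\<bar>c'\<bar> + 2 * d * s') + 1/1000 < c' * (3 * p - 3/2) + s' * (3 * (d + q))"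
    and "1 + 2 * \<bar>c' * p + s' * q\<bar> + 1/1000 < c' * (3 * p - 3/2) + s' * (3 * (d + q))"
    and "1 + 1/1000 < 3 * (d + q) * s'"
  shows "admissible k d p q m m'"
proof -
  have "(1/2)\<^sup>2 = (1/4 :: real)" by (simp add: power2_eq_square)
  then have "q\<^sup>2 < (1/2)\<^sup>2" using assms(7) zero_le_power2[of p] by linarith
  then have q: "q < 1/2" by (rule power2_less_imp_less) simp
  have "3141/1000 < pi" using pi_approx(1) by simp
  then have "4 * real k * d < pi" using assms(6) by linarith
  have bounds: "\<bar>1/2 + 3 * p\<bar> \<le> 2" "\<bar>3 * p - 3/2\<bar> \<le> 2" "\<bar>3 * (d + q)\<bar> \<le> 3"
    "\<bar>d\<bar> \<le> 1/2" "\<bar>p\<bar> \<le> 1/2" "\<bar>q\<bar> \<le> 1/2"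
    using assms(2-5) q by (simp_all add: abs_le_iff)
  note \<open>4 * real k * d < pi\<close>
  moreover have "separates k d p q m (1/2 + 3 * p, 3 * (d + q))"
    by (rule separatesI[OF assms(8,9,12,13,16,17) bounds(1,3-6)])
  moreover have "separates k d p q m' (3 * p - 3/2, 3 * (d + q))"
    by (rule separatesI[OF assms(10,11,14,15,18,19) bounds(2-6)])
  moreover have "3 * (d + q) * sin (real m' * pi / real k) > 1"
  proof -
    have "\<bar>sin (real m' * pi / real k) - s'\<bar> \<le> 1/10000"
      using assms(1,11,15) by (intro angle_approx(2)) simp_all
    then have "s' - 1/10000 \<le> sin (real m' * pi / real k)" by linarith
    moreover define H where "H = 3 * (d + q)"
    moreover have "0 < H" "H < 3" using assms(2,3) q by (simp_all add: H_def)
    ultimately have "H * (s' - 1/10000) \<le> H * sin (real m' * pi / real k)"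
      by (intro mult_left_mono) simp_all
    then have "H * s' - H / 10000 \<le> H * sin (real m' * pi / real k)"
      by (simp add: right_diff_distrib)
    moreover have "1 + 1/1000 < H * s'" using assms(20) by (simp add: H_def)
    ultimately have "1 < H * sin (real m' * pi / real k)" using \<open>H < 3\<close> by linarith
    then show ?thesis by (simp add: H_def)
  qed
  ultimately show ?thesis using assms unfolding admissible_def by blast
qed

lemma admissible_exists:
  assumes "2 \<le> k" "k \<le> 11"
  shows "\<exists>d p q m m'. admissible k d p q m m'"
proof -
  \<comment> \<open>In each case the decimals are the cosines and sines of \<open>m * pi / k\<close>
    and \<open>m' * pi / k\<close> to five places. For \<open>k = 11\<close> little room is left:
    \<open>d\<close> is about \<open>0.0710\<close> against \<open>pi / 44\<close>, about
    \<open>0.0714\<close>, and \<open>p\<^sup>2 + q\<^sup>2\<close> about \<open>0.2494\<close>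
    against \<open>0.25\<close>.\<close>
  have "admissible 2 (2/7) (1/7) (3/7) 1 1"
    by (rule admissibleI[where c = "0/100000" and s = "100000/100000" and c' = "0/100000" and s' = "100000/100000"])
      (simp_all add: cos_poly_def sin_poly_def power_divide)
  moreover
  have "admissible 3 (2/9) (2/9) (4/9) 1 2"
    by (rule admissibleI[where c = "50000/100000" and s = "86603/100000" and c' = "-50000/100000" and s' = "86603/100000"])
      (simp_all add: cos_poly_def sin_poly_def power_divide)
  moreover
  have "admissible 4 (2/11) (2/11) (5/11) 1 3"
    by (rule admissibleI[where c = "70711/100000" and s = "70711/100000" and c' = "-70711/100000" and s' = "70711/100000"])
      (simp_all add: cos_poly_def sin_poly_def power_divide)
  moreover
  have "admissible 5 (2/13) (4/13) (5/13) 1 3"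
    by (rule admissibleI[where c = "80902/100000" and s = "58779/100000" and c' = "-30902/100000" and s' = "95106/100000"])
      (simp_all add: cos_poly_def sin_poly_def power_divide)
  moreover
  have "admissible 6 (2/16) (3/16) (7/16) 2 4"
    by (rule admissibleI[where c = "50000/100000" and s = "86603/100000" and c' = "-50000/100000" and s' = "86603/100000"])
      (simp_all add: cos_poly_def sin_poly_def power_divide)
  moreover
  have "admissible 7 (1/9) (2/9) (4/9) 2 4"
    by (rule admissibleI[where c = "62349/100000" and s = "78183/100000" and c' = "-22252/100000" and s' = "97493/100000"])
      (simp_all add: cos_poly_def sin_poly_def power_divide)
  moreover
  have "admissible 8 (2/21) (5/21) (9/21) 2 5"
    by (rule admissibleI[where c = "70711/100000" and s = "70711/100000" and c' = "-38268/100000" and s' = "92388/100000"])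
      (simp_all add: cos_poly_def sin_poly_def power_divide)
  moreover
  have "admissible 9 (3/35) (9/35) (15/35) 2 6"
    by (rule admissibleI[where c = "76604/100000" and s = "64279/100000" and c' = "-50000/100000" and s' = "86603/100000"])
      (simp_all add: cos_poly_def sin_poly_def power_divide)
  moreover
  have "admissible 10 (5/64) (17/64) (27/64) 2 6"
    by (rule admissibleI[where c = "80902/100000" and s = "58779/100000" and c' = "-30902/100000" and s' = "95106/100000"])
      (simp_all add: cos_poly_def sin_poly_def power_divide)
  moreover
  have "admissible 11 (12/169) (50/169) (68/169) 2 7"
    by (rule admissibleI[where c = "84125/100000" and s = "54064/100000" and c' = "-41542/100000" and s' = "90963/100000"])
      (simp_all add: cos_poly_def sin_poly_def power_divide)
  moreover have "k \<in> {2, 3, 4, 5, 6, 7, 8, 9, 10, 11}"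
    using assms unfolding insert_iff empty_iff by presburger
  ultimately show ?thesis by blast
qed

subsection \<open>The colouring\<close>

theorem theorem1:
  fixes k :: nat and C :: "(real^2) set"
  assumes "regular_polygon (2 * k) 0 C" and "k \<le> 11"
  shows "(\<exists>K. proper_coloring C 6 K \<and> regular_coloring 6 K) \<and> chromatic_number C \<le> 6"
proof -
  have "k \<ge> 2" using assms(1) by (auto simp: regular_polygon_def)
  obtain \<rho> \<alpha> where \<rho>: "\<rho> > 0" and C: "C = {P. \<forall>m<k. \<bar>facet k m (coords \<rho> \<alpha> P)\<bar> \<le> 1}"
    using regular_polygon_eq[OF assms(1)] by blast
  obtain d p q m m' where adm: "admissible k d p q m m'"
    using admissible_exists[OF \<open>k \<ge> 2\<close> assms(2)] by blast
  define l where "l = lattice_point (1/2 + p) (d + q)"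
  obtain col where col: "\<And>Q i j. col (Q + l i j) = col Q + (3 * i + j)"
    and same: "\<And>Q Q' n. col Q - col Q' = 6 * n \<Longrightarrow>
       \<exists>R R' i j. in_tile d p q R \<and> in_tile d p q R' \<and> Q - Q' = R - R' + l i j \<and> 3 * i + j = 6 * n"
    unfolding l_def by (rule lattice_coloring_exists[of d q p]) (use adm in \<open>auto simp: admissible_def\<close>)
  define K where "K i = {P. col (coords \<rho> \<alpha> P) mod 6 = int i mod 6}" for i
  \<comment> \<open>One row up adds \<open>1\<close> to the colour, so \<open>i - 1\<close> rows
    carry class \<open>1\<close> to class \<open>i\<close>.\<close>
  define v where "v i = point \<rho> \<alpha> (l 0 (int i - 1))" for i
  have col_v: "col (coords \<rho> \<alpha> (P + v i)) = col (coords \<rho> \<alpha> P) + (int i - 1)" for P i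
    by (simp add: v_def coords_add coords_point[OF \<rho>] col)
  have mod_shift: "(a + (int i - 1)) mod 6 = int i mod 6 \<longleftrightarrow> a mod 6 = int 1 mod 6" for a i
    unfolding mod_eq_dvd_iff by simp
  have translate: "K i = (\<lambda>x. x + v i) ` K 1" for i
  proof (intro equalityI subsetI)
    fix P assume P: "P \<in> K i"
    have "col (coords \<rho> \<alpha> (P - v i)) + (int i - 1) = col (coords \<rho> \<alpha> P)"
      using col_v[of "P - v i" i] by simp
    then have "P - v i \<in> K 1" using P unfolding K_def mem_Collect_eq by (metis mod_shift)
    then show "P \<in> (\<lambda>x. x + v i) ` K 1" by (intro image_eqI[of _ _ "P - v i"]) auto
  next
    fix P assume "P \<in> (\<lambda>x. x + v i) ` K 1"
    then obtain P' where "P' \<in> K 1" "P = P' + v i" by blast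
    then show "P \<in> K i" unfolding K_def mem_Collect_eq by (metis col_v mod_shift)
  qed
  have cover: "(\<Union>i\<in>{1..6}. K i) = UNIV"
  proof -
    have "\<exists>i\<in>{1..6}. P \<in> K i" for P
    proof -
      \<comment> \<open>Classes are numbered from \<open>1\<close>, so residue \<open>0\<close>
        belongs to class \<open>6\<close>.\<close>
      have "nat ((col (coords \<rho> \<alpha> P) - 1) mod 6) + 1 \<in> {1..6}" "P \<in> K (nat ((col (coords \<rho> \<alpha> P) - 1) mod 6) + 1)"
        by (simp_all add: K_def) presburger+
      then show ?thesis by blast
    qed
    then show ?thesis by blast
  qed
  \<comment> \<open>Some class is nonempty because the classes cover the plane, and all are
    translates of \<open>K 1\<close>.\<close>
  have "K i \<noteq> {}" for i
    using cover translate by blast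
  moreover have "disjoint_family_on K {1..6}"
  proof -
    have "i = j" if "i \<in> {1..6}" "j \<in> {1..6}" "P \<in> K i" "P \<in> K j" for i j P
    proof -
      have "int i mod 6 = int j mod 6" using that(3,4) by (simp add: K_def)
      then obtain n where n: "int i - int j = 6 * n" unfolding mod_eq_dvd_iff by (elim dvdE)
      then have "n = 0" using that(1,2) by simp
      then show ?thesis using n by simp
    qed
    then show ?thesis unfolding disjoint_family_on_def by blast
  qed
  moreover have "C_dist C P P' \<noteq> 1" if "P \<in> K i" "P' \<in> K i" for P P' i
  proof
    assume "C_dist C P P' = 1"
    then have "C_norm C (P - P') = 1" by (simp add: C_dist_def)
    note unit = C_norm_eq_1[OF C _ _ this]
    have "col (coords \<rho> \<alpha> P) mod 6 = col (coords \<rho> \<alpha> P') mod 6"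
      using that by (simp add: K_def)
    then have "6 dvd col (coords \<rho> \<alpha> P) - col (coords \<rho> \<alpha> P')"
      by (simp add: mod_eq_dvd_iff)
    then obtain n where "col (coords \<rho> \<alpha> P) - col (coords \<rho> \<alpha> P') = 6 * n" by (elim dvdE)
    then obtain R R' i j where R: "in_tile d p q R" "in_tile d p q R'"
      "coords \<rho> \<alpha> (P - P') = R - R' + lattice_point (1/2 + p) (d + q) i j" "3 * i + j = 6 * n"
      using same unfolding coords_diff l_def by metis
    show False
      using same_color_facet[OF adm R] unit \<open>k \<ge> 2\<close> by (auto simp: coords_scaleR facet_scaleR)
  qed
  ultimately have "proper_coloring C 6 K"
    unfolding proper_coloring_def using cover by auto
  moreover have "regular_coloring 6 K"
    unfolding regular_coloring_def using translate by blast
  moreover have "chromatic_number C \<le> 6"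
  proof -
    have "chromatic_number C \<le> enat 6"
      unfolding chromatic_number_def using \<open>proper_coloring C 6 K\<close> by (intro Inf_lower) blast
    then show ?thesis by (simp add: numeral_eq_enat)
  qed
  ultimately show ?thesis by blast
qed

end
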